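(* Let $X$ be a rearrangement invariant sequence space with the Fatou property. Further, let $w$ be a positive and decreasing function on $(0,\infty)$ such that $w\notin X$. Suppose that, up to an equivalent norm, the space $[X(w)]^{\bigstar}$ is a Banach space. Then $$[X(w)^{\bigstar}]_o=[X_o(w)]^{\bigstar}.$$
   Context: A Köthe sequence space is a Banach space $X$ that is a linear subspace of the space of all sequences, with $|x|\le|y|$ and $y\in X$ implying $x\in X$, $\|x\|_X\le\|y\|_X$, and containing all finitely supported sequences. It is rearrangement invariant if $x$ equi-measurable (w.r.t. counting measure) with $y\in X$ implies $x\in X$, $\|x\|_X=\|y\|_X$. Fatou property: the closed unit ball is closed under coordinatewise convergence. The function $w$ is identified with the sequence $\{w(n)\}_{n=1}^\infty$ (so $w\notin X$ means $\{w(n)\}\notin X$). $X(w)=\{x:xw\in X\}$ with $\|x\|_{X(w)}=\|xw\|_X$. The symmetrization is $X^{\bigstar}=\{x:x^\star\in X\}$ with $\|x\|_{X^{\bigstar}}=\|x^\star\|_X$, $x^\star$ being the decreasing rearrangement of $|x|$; $X(w)^{\bigstar}=[X(w)]^{\bigstar}$. $Z_o$ is the set of $z\in Z$ with $\|z^{(n)}\|_Z\to0$ whenever $0\le z^{(n)}\le|z|$, $z^{(n)}\downarrow0$ pointwise; $X_o(w)=(X_o)(w)$. *)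

theory Defs
  imports "HOL-Analysis.Analysis"
begin

(* The class real_normed_field has, up to isomorphism, only the members real and complex
   (Gelfand-Mazur / Ostrowski), so a scalar type 'a of this class covers exactly the real and
   the complex sequence spaces.
   Index k :: nat stands for the index k + 1 of a sequence numbered from 1.
   A space is a set of sequences together with a (quasi-)norm; the values of norm_of outside
   the carrier carry no meaning. *)

record 'a seq_space =
  carrier :: "(nat \<Rightarrow> 'a) set"
  norm_of :: "(nat \<Rightarrow> 'a) \<Rightarrow> real"

definition linear_subspace :: "(nat \<Rightarrow> 'a::real_normed_field) set \<Rightarrow> bool" where
  "linear_subspace A \<longleftrightarrow>
     (\<lambda>k. 0) \<in> A \<and>
     (\<forall>x\<in>A. \<forall>y\<in>A. (\<lambda>k. x k + y k) \<in> A) \<and>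
     (\<forall>c. \<forall>x\<in>A. (\<lambda>k. c * x k) \<in> A)"

definition normed_seq_space :: "'a::real_normed_field seq_space \<Rightarrow> bool" where
  "normed_seq_space X \<longleftrightarrow>
     linear_subspace (carrier X) \<and>
     (\<forall>x\<in>carrier X. norm_of X x \<ge> 0) \<and>
     (\<forall>x\<in>carrier X. norm_of X x = 0 \<longleftrightarrow> x = (\<lambda>k. 0)) \<and>
     (\<forall>c. \<forall>x\<in>carrier X. norm_of X (\<lambda>k. c * x k) = norm c * norm_of X x) \<and>
     (\<forall>x\<in>carrier X. \<forall>y\<in>carrier X.
        norm_of X (\<lambda>k. x k + y k) \<le> norm_of X x + norm_of X y)"

definition banach_seq_space :: "'a::real_normed_field seq_space \<Rightarrow> bool" where
  "banach_seq_space X \<longleftrightarrow>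
     normed_seq_space X \<and>
     (\<forall>s :: nat \<Rightarrow> nat \<Rightarrow> 'a.
        (\<forall>n. s n \<in> carrier X) \<and>
        (\<forall>e>0. \<exists>M. \<forall>m\<ge>M. \<forall>n\<ge>M. norm_of X (\<lambda>k. s m k - s n k) < e) \<longrightarrow>
        (\<exists>l\<in>carrier X. (\<lambda>n. norm_of X (\<lambda>k. s n k - l k)) \<longlonglongrightarrow> 0))"

definition banach_up_to_equiv_norm :: "'a::real_normed_field seq_space \<Rightarrow> bool" where
  "banach_up_to_equiv_norm Z \<longleftrightarrow>
     (\<exists>N. banach_seq_space \<lparr>carrier = carrier Z, norm_of = N\<rparr> \<and>
        (\<exists>c>0. \<exists>C>0. \<forall>x\<in>carrier Z. c * norm_of Z x \<le> N x \<and> N x \<le> C * norm_of Z x))"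

definition koethe_seq_space :: "'a::real_normed_field seq_space \<Rightarrow> bool" where
  "koethe_seq_space X \<longleftrightarrow>
     banach_seq_space X \<and>
     (\<forall>x y. y \<in> carrier X \<and> (\<forall>k. norm (x k) \<le> norm (y k)) \<longrightarrow>
        x \<in> carrier X \<and> norm_of X x \<le> norm_of X y) \<and>
     (\<forall>x. finite {k. x k \<noteq> 0} \<longrightarrow> x \<in> carrier X)"

definition distribution_fun :: "(nat \<Rightarrow> 'a::real_normed_field) \<Rightarrow> real \<Rightarrow> ennreal" where
  "distribution_fun x t = emeasure (count_space UNIV) {k. norm (x k) > t}"

definition equimeasurable ::
    "(nat \<Rightarrow> 'a::real_normed_field) \<Rightarrow> (nat \<Rightarrow> 'a) \<Rightarrow> bool" where
  "equimeasurable x y \<longleftrightarrow> (\<forall>t\<ge>0. distribution_fun x t = distribution_fun y t)"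

definition rearrangement_invariant :: "'a::real_normed_field seq_space \<Rightarrow> bool" where
  "rearrangement_invariant X \<longleftrightarrow>
     koethe_seq_space X \<and>
     (\<forall>x y. y \<in> carrier X \<and> equimeasurable x y \<longrightarrow>
        x \<in> carrier X \<and> norm_of X x = norm_of X y)"

definition fatou_property :: "'a::real_normed_field seq_space \<Rightarrow> bool" where
  "fatou_property X \<longleftrightarrow>
     (\<forall>(s :: nat \<Rightarrow> nat \<Rightarrow> 'a) l.
        (\<forall>n. s n \<in> carrier X \<and> norm_of X (s n) \<le> 1) \<and> (\<forall>k. (\<lambda>n. s n k) \<longlonglongrightarrow> l k) \<longrightarrow>
        l \<in> carrier X \<and> norm_of X l \<le> 1)"

(* With index n standing for n + 1, the bound on the distribution function is the usual
   "fewer than n + 1 entries exceed t".  The set is nonempty exactly when x is bounded;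
   for unbounded x the decreasing rearrangement is infinite and the value here is junk. *)
definition decr_rearr :: "(nat \<Rightarrow> 'a::real_normed_field) \<Rightarrow> nat \<Rightarrow> real" where
  "decr_rearr x n = Inf {t. 0 \<le> t \<and> distribution_fun x t \<le> of_nat n}"

definition weighted ::
    "'a::real_normed_field seq_space \<Rightarrow> (nat \<Rightarrow> real) \<Rightarrow> 'a seq_space" where
  "weighted X w =
     \<lparr>carrier = {x. (\<lambda>k. x k * of_real (w k)) \<in> carrier X},
      norm_of = (\<lambda>x. norm_of X (\<lambda>k. x k * of_real (w k)))\<rparr>"

(* Boundedness of x says that its decreasing rearrangement is a (finite-valued) sequence. *)
definition symmetrization :: "'a::real_normed_field seq_space \<Rightarrow> 'a seq_space" where
  "symmetrization X =
     \<lparr>carrier = {x. bounded (range x) \<and> (\<lambda>n. of_real (decr_rearr x n)) \<in> carrier X},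
      norm_of = (\<lambda>x. norm_of X (\<lambda>n. of_real (decr_rearr x n)))\<rparr>"

definition oc_part :: "'a::real_normed_field seq_space \<Rightarrow> 'a seq_space" where
  "oc_part Z =
     \<lparr>carrier = {z \<in> carrier Z.
        \<forall>u :: nat \<Rightarrow> nat \<Rightarrow> real.
          (\<forall>n k. 0 \<le> u n k \<and> u n k \<le> norm (z k)) \<and>
          (\<forall>k. decseq (\<lambda>n. u n k) \<and> (\<lambda>n. u n k) \<longlonglongrightarrow> 0) \<longrightarrow>
          (\<lambda>n. norm_of Z (\<lambda>k. of_real (u n k))) \<longlonglongrightarrow> 0},
      norm_of = norm_of Z\<rparr>"

definition seq_of :: "(real \<Rightarrow> real) \<Rightarrow> nat \<Rightarrow> real" where
  "seq_of w k = w (real (Suc k))"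

end

theory Submission
  imports Defs
begin

text \<open>
  Write \<open>Z\<close> for the symmetrization of \<open>X(w)\<close>, \<open>x\<^sup>\<star>\<close> for \<open>decr_rearr x\<close>, and \<open>\<chi>\<close> for an indicator.
  The norms of the two spaces agree by definition, so the matter is the equality of the carriers.

  Every order continuous \<open>x \<in> Z\<close> has \<open>x\<^sup>\<star> w \<in> X\<^sub>o\<close>:
  the tails \<open>|x| \<chi>\<^bsub>[n,\<infinity>)\<^esub>\<close> decrease to 0, so their norms in \<open>Z\<close> tend to 0.
  Deleting \<open>n\<close> entries moves the decreasing rearrangement by at most \<open>n\<close> places, that is,
  \<open>x\<^sup>\<star>(k + n) \<le> (x \<chi>\<^bsub>[n,\<infinity>)\<^esub>)\<^sup>\<star>(k)\<close> (\<open>decr_rearr_shift_le_tail\<close>). As \<open>w\<close> decreases and \<open>X\<close> does not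
  feel a shift (\<open>tail_shift\<close>), the norm in \<open>X\<close> of the \<open>n\<close>-th tail of \<open>x\<^sup>\<star> w\<close> is at most the norm
  in \<open>Z\<close> of the \<open>n\<close>-th tail of \<open>x\<close>. Finally an element of a Koethe space whose tails tend to 0 in
  norm is order continuous (\<open>oc_part_if_tails_tendsto_0\<close>).

  Conversely, let \<open>x\<^sup>\<star> w \<in> X\<^sub>o\<close>. If \<open>x\<^sup>\<star>\<close> stayed above some \<open>c > 0\<close>, then \<open>c w \<le> x\<^sup>\<star> w\<close> would put \<open>w\<close>
  into \<open>X\<close>; hence \<open>x\<close> is a null sequence. So if \<open>0 \<le> u\<^sub>n \<le> |x|\<close> decrease to 0 pointwise, they do so
  uniformly, because outside a finite set they are all small (\<open>dominated_eventually_small\<close>).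
  Therefore the sequences \<open>u\<^sub>n\<^sup>\<star> w\<close>, which lie below \<open>x\<^sup>\<star> w\<close>, decrease to 0 pointwise, and order
  continuity of \<open>x\<^sup>\<star> w\<close> in \<open>X\<close> makes their norms tend to 0.
\<close>

section \<open>Decreasing rearrangements\<close>

lemma distribution_fun_mono:
  assumes "\<And>k. norm (x k) \<le> norm (y k)"
  shows "distribution_fun x t \<le> distribution_fun y t"
  unfolding distribution_fun_def
  by (rule emeasure_mono) (use assms in \<open>auto intro: less_le_trans\<close>)

lemma distribution_fun_eq_0:
  assumes "\<And>k. norm (x k) \<le> t"
  shows "distribution_fun x t = 0"
proof -
  have "{k. norm (x k) > t} = {}"
    using assms by (auto simp: not_less)
  then show ?thesis
    by (simp add: distribution_fun_def)
qed

lemma distribution_fun_le_of_nat_finite: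
  assumes "distribution_fun x t \<le> of_nat n"
  shows "finite {k. norm (x k) > t}"
proof (rule ccontr)
  assume "infinite {k. norm (x k) > t}"
  then show False
    using assms by (simp add: distribution_fun_def top_unique)
qed

lemma decr_rearr_le:
  assumes "0 \<le> t" "distribution_fun x t \<le> of_nat n"
  shows "decr_rearr x n \<le> t"
  unfolding decr_rearr_def
  by (rule cInf_lower) (use assms in \<open>auto intro: bdd_belowI[of _ 0]\<close>)

text \<open>Boundedness makes the set of admissible levels nonempty, so that its infimum is not a
  default value.\<close>
lemma le_decr_rearr:
  assumes "bounded (range x)"
    and "\<And>t. 0 \<le> t \<Longrightarrow> distribution_fun x t \<le> of_nat n \<Longrightarrow> c \<le> t"
  shows "c \<le> decr_rearr x n"
proof -
  obtain B where "\<And>k. norm (x k) \<le> B"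
    using assms(1) by (auto simp: bounded_iff)
  moreover from this[of 0] have "0 \<le> B"
    by (rule order_trans[OF norm_ge_zero])
  ultimately have "B \<in> {t. 0 \<le> t \<and> distribution_fun x t \<le> of_nat n}"
    by (simp add: distribution_fun_eq_0)
  then show ?thesis
    unfolding decr_rearr_def by (intro cInf_greatest) (use assms(2) in auto)
qed

lemma decr_rearr_nonneg: "bounded (range x) \<Longrightarrow> 0 \<le> decr_rearr x n"
  by (rule le_decr_rearr)

lemma decr_rearr_le_bound:
  assumes "\<And>k. norm (x k) \<le> t"
  shows "decr_rearr x n \<le> t"
proof (rule decr_rearr_le)
  show "0 \<le> t"
    by (rule order_trans[OF norm_ge_zero assms[of 0]])
qed (simp add: distribution_fun_eq_0[OF assms])

lemma decr_rearr_mono: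
  assumes "bounded (range y)" "\<And>k. norm (x k) \<le> norm (y k)"
  shows "decr_rearr x n \<le> decr_rearr y n"
proof (rule le_decr_rearr[OF assms(1)])
  fix t :: real
  assume t: "0 \<le> t" "distribution_fun y t \<le> of_nat n"
  show "decr_rearr x n \<le> t"
    by (rule decr_rearr_le[OF t(1) order_trans[OF distribution_fun_mono[OF assms(2)] t(2)]])
qed

lemma bounded_range_dominated:
  fixes x :: "nat \<Rightarrow> 'a::real_normed_vector" and y :: "nat \<Rightarrow> 'b::real_normed_vector"
  assumes "bounded (range y)" "\<And>k. norm (x k) \<le> norm (y k)"
  shows "bounded (range x)"
proof -
  obtain B where "\<And>k. norm (y k) \<le> B"
    using assms(1) by (auto simp: bounded_iff)
  then have "norm (x k) \<le> B" for k
    by (rule order_trans[OF assms(2)])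
  then show ?thesis
    by (auto simp: bounded_iff)
qed

text \<open>If at most \<open>n\<close> entries of the tail exceed \<open>t\<close>, then at most \<open>n + m\<close> entries of \<open>x\<close> do, since
  only \<open>m\<close> entries were deleted.\<close>
lemma decr_rearr_shift_le_tail:
  fixes x :: "nat \<Rightarrow> 'a::real_normed_field"
  assumes "bounded (range x)"
  shows "decr_rearr x (n + m) \<le> decr_rearr (\<lambda>k. if m \<le> k then x k else 0) n"
    (is "_ \<le> decr_rearr ?y n")
proof (rule le_decr_rearr)
  show "bounded (range ?y)"
    by (rule bounded_range_dominated[OF assms]) auto
  fix t :: real
  assume t: "0 \<le> t" "distribution_fun ?y t \<le> of_nat n"
  have "{k. norm (x k) > t} \<subseteq> {k. norm (?y k) > t} \<union> {..<m}"
    by auto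
  then have "distribution_fun x t
      \<le> emeasure (count_space UNIV) ({k. norm (?y k) > t} \<union> {..<m})"
    unfolding distribution_fun_def by (rule emeasure_mono) auto
  also have "\<dots> \<le> distribution_fun ?y t + emeasure (count_space UNIV) {..<m}"
    unfolding distribution_fun_def by (rule emeasure_subadditive) auto
  also have "\<dots> \<le> of_nat n + of_nat m"
    by (rule add_mono[OF t(2)]) (simp add: emeasure_count_space)
  finally show "decr_rearr x (n + m) \<le> t"
    by (intro decr_rearr_le t(1)) simp
qed

lemma finite_if_decr_rearr_less:
  assumes "bounded (range x)" "decr_rearr x n < e"
  shows "finite {k. norm (x k) > e}"
proof -
  have "\<not> (\<forall>t. 0 \<le> t \<and> distribution_fun x t \<le> of_nat n \<longrightarrow> e \<le> t)"
    using le_decr_rearr[OF assms(1), of n e] assms(2) by auto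
  then obtain t where t: "distribution_fun x t \<le> of_nat n" "t < e"
    by auto
  show ?thesis
    by (rule finite_subset[OF _ distribution_fun_le_of_nat_finite[OF t(1)]]) (use t(2) in auto)
qed

text \<open>A Dini-type fact: only the finitely many coordinates where the dominating sequence exceeds
  \<open>e\<close> have to be waited for.\<close>
lemma dominated_eventually_small:
  fixes u :: "nat \<Rightarrow> nat \<Rightarrow> real"
  assumes "finite {k. b k > e}" "e > 0"
    and "\<And>n k. \<bar>u n k\<bar> \<le> b k" "\<And>k. (\<lambda>n. u n k) \<longlonglongrightarrow> 0"
  shows "\<forall>\<^sub>F n in sequentially. \<forall>k. \<bar>u n k\<bar> \<le> e"
proof -
  have "\<forall>\<^sub>F n in sequentially. \<bar>u n k\<bar> \<le> e" for k
    using tendstoD[OF assms(4)[of k] assms(2)] by eventually_elim simp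
  then have "\<forall>\<^sub>F n in sequentially. \<forall>k\<in>{k. b k > e}. \<bar>u n k\<bar> \<le> e"
    by (intro eventually_ball_finite assms(1)) blast
  then show ?thesis
  proof eventually_elim
    case (elim n)
    show ?case
    proof
      show "\<bar>u n k\<bar> \<le> e" for k
        using elim assms(3)[of n k] by (cases "b k > e") auto
    qed
  qed
qed

section \<open>Order continuity through tails\<close>

lemma oc_part_carrierD: "z \<in> carrier (oc_part Z) \<Longrightarrow> z \<in> carrier Z"
  by (simp add: oc_part_def)

lemma oc_partD:
  assumes "z \<in> carrier (oc_part Z)"
    and "\<And>n k. 0 \<le> u n k \<and> u n k \<le> norm (z k)"
    and "\<And>k. decseq (\<lambda>n. u n k)" "\<And>k. (\<lambda>n. u n k) \<longlonglongrightarrow> 0"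
  shows "(\<lambda>n. norm_of Z (\<lambda>k. of_real (u n k))) \<longlonglongrightarrow> 0"
proof -
  have "\<forall>u. (\<forall>n k. 0 \<le> u n k \<and> u n k \<le> norm (z k)) \<and>
      (\<forall>k. decseq (\<lambda>n. u n k) \<and> (\<lambda>n. u n k) \<longlonglongrightarrow> 0) \<longrightarrow>
      (\<lambda>n. norm_of Z (\<lambda>k. of_real (u n k))) \<longlonglongrightarrow> 0"
    using assms(1) unfolding oc_part_def seq_space.simps by (elim CollectE conjE)
  then show ?thesis
    using assms(2-4) by blast
qed

lemma oc_partI:
  fixes Z :: "'a::real_normed_field seq_space"
  assumes "z \<in> carrier Z"
    and "\<And>u. (\<And>n k. 0 \<le> u n k) \<Longrightarrow> (\<And>n k. u n k \<le> norm (z k)) \<Longrightarrow>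
      (\<And>k. decseq (\<lambda>n. u n k)) \<Longrightarrow> (\<And>k. (\<lambda>n. u n k) \<longlonglongrightarrow> 0) \<Longrightarrow>
      (\<lambda>n. norm_of Z (\<lambda>k. of_real (u n k))) \<longlonglongrightarrow> 0"
  shows "z \<in> carrier (oc_part Z)"
  unfolding oc_part_def seq_space.simps
  by (intro CollectI conjI allI impI) (use assms in blast)+

lemma koethe_linear: "koethe_seq_space X \<Longrightarrow> linear_subspace (carrier X)"
  unfolding koethe_seq_space_def banach_seq_space_def normed_seq_space_def by (elim conjE)

lemma koethe_scale: "koethe_seq_space X \<Longrightarrow> x \<in> carrier X \<Longrightarrow> (\<lambda>k. c * x k) \<in> carrier X"
  by (drule koethe_linear, unfold linear_subspace_def, elim conjE, drule spec, erule bspec)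

lemma koethe_norm_nonneg: "koethe_seq_space X \<Longrightarrow> x \<in> carrier X \<Longrightarrow> 0 \<le> norm_of X x"
  unfolding koethe_seq_space_def banach_seq_space_def normed_seq_space_def by blast

lemma koethe_norm_zero: "koethe_seq_space X \<Longrightarrow> norm_of X (\<lambda>k. 0) = 0"
  unfolding koethe_seq_space_def banach_seq_space_def normed_seq_space_def linear_subspace_def
  by blast

lemma koethe_norm_scale:
  "koethe_seq_space X \<Longrightarrow> x \<in> carrier X \<Longrightarrow> norm_of X (\<lambda>k. c * x k) = norm c * norm_of X x"
  unfolding koethe_seq_space_def banach_seq_space_def normed_seq_space_def by blast

lemma koethe_norm_triangle:
  "koethe_seq_space X \<Longrightarrow> x \<in> carrier X \<Longrightarrow> y \<in> carrier X \<Longrightarrow>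
    norm_of X (\<lambda>k. x k + y k) \<le> norm_of X x + norm_of X y"
  unfolding koethe_seq_space_def banach_seq_space_def normed_seq_space_def by blast

lemma koethe_ideal:
  "koethe_seq_space X \<Longrightarrow> y \<in> carrier X \<Longrightarrow> (\<And>k. norm (x k) \<le> norm (y k)) \<Longrightarrow> x \<in> carrier X"
  unfolding koethe_seq_space_def by blast

lemma koethe_norm_mono:
  "koethe_seq_space X \<Longrightarrow> y \<in> carrier X \<Longrightarrow> (\<And>k. norm (x k) \<le> norm (y k)) \<Longrightarrow>
    norm_of X x \<le> norm_of X y"
  unfolding koethe_seq_space_def by blast

lemma koethe_finite_support:
  "koethe_seq_space X \<Longrightarrow> finite {k. x k \<noteq> 0} \<Longrightarrow> x \<in> carrier X"
  unfolding koethe_seq_space_def by blast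

text \<open>On a fixed finite set of coordinates, coordinatewise convergence is norm convergence:
  each coordinate contributes at most its size times the norm of a unit vector.\<close>
lemma koethe_truncation_tendsto_0:
  fixes X :: "'a::real_normed_field seq_space"
  assumes X: "koethe_seq_space X" and s: "\<And>k. (\<lambda>n. s n k) \<longlonglongrightarrow> 0"
  shows "(\<lambda>n. norm_of X (\<lambda>k. if k < m then s n k else 0)) \<longlonglongrightarrow> 0"
proof (induction m)
  case 0
  then show ?case
    by (simp add: koethe_norm_zero[OF X])
next
  case (Suc m)
  let ?e = "\<lambda>k. if k = m then 1 else (0::'a)"
  have e: "?e \<in> carrier X"
    by (rule koethe_finite_support[OF X]) simp
  have carr: "(\<lambda>k. if k < j then s n k else 0) \<in> carrier X" for j n
    by (rule koethe_finite_support[OF X], rule finite_subset[of _ "{..<j}"]) auto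
  have split: "(\<lambda>k. if k < Suc m then s n k else 0)
      = (\<lambda>k. (if k < m then s n k else 0) + s n m * ?e k)" for n
    by (auto simp: less_Suc_eq)
  have scaled: "(\<lambda>k. s n m * ?e k) \<in> carrier X" for n
    by (rule koethe_scale[OF X e])
  have le: "norm_of X (\<lambda>k. if k < Suc m then s n k else 0)
      \<le> norm_of X (\<lambda>k. if k < m then s n k else 0) + norm (s n m) * norm_of X ?e" for n
    using koethe_norm_triangle[OF X carr[of m n] scaled[of n]]
      koethe_norm_scale[OF X e, of "s n m"]
    unfolding split by linarith
  have "(\<lambda>n. norm_of X (\<lambda>k. if k < m then s n k else 0) + norm (s n m) * norm_of X ?e)
      \<longlonglongrightarrow> 0 + norm (0::'a) * norm_of X ?e"
    by (intro tendsto_intros Suc.IH s)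
  then have lim: "(\<lambda>n. norm_of X (\<lambda>k. if k < m then s n k else 0) + norm (s n m) * norm_of X ?e)
      \<longlonglongrightarrow> 0"
    by simp
  show ?case
    by (intro tendsto_sandwich[OF _ _ tendsto_const lim] always_eventually allI
        le koethe_norm_nonneg[OF X carr])
qed

text \<open>Cut a decreasing family \<open>u\<^sub>n \<le> |y|\<close> at a place \<open>m\<close> where the tail of \<open>y\<close> has small norm: beyond
  \<open>m\<close> every \<open>u\<^sub>n\<close> is dominated by that tail, and before \<open>m\<close> only finitely many coordinates have to
  become small.\<close>
lemma oc_part_if_tails_tendsto_0:
  fixes X :: "'a::real_normed_field seq_space"
  assumes X: "koethe_seq_space X" and y: "y \<in> carrier X"
    and tails: "(\<lambda>m. norm_of X (\<lambda>k. if m \<le> k then y k else 0)) \<longlonglongrightarrow> 0"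
  shows "y \<in> carrier (oc_part X)"
proof -
  have "(\<lambda>n. norm_of X (\<lambda>k. of_real (u n k))) \<longlonglongrightarrow> 0"
    if u: "\<And>n k. 0 \<le> u n k" "\<And>n k. u n k \<le> norm (y k)" "\<And>k. (\<lambda>n. u n k) \<longlonglongrightarrow> 0"
    for u :: "nat \<Rightarrow> nat \<Rightarrow> real"
  proof (rule LIMSEQ_I)
    fix e :: real
    assume e: "e > 0"
    let ?tail = "\<lambda>m k. if m \<le> k then y k else 0"
    let ?head = "\<lambda>m n k. if k < m then of_real (u n k) else (0::'a)"
    obtain m where m: "norm_of X (?tail m) < e / 2"
      using order_tendstoD(2)[OF tails, of "e / 2"] e by (auto simp: eventually_sequentially)
    have tailX: "?tail m \<in> carrier X"
      by (rule koethe_ideal[OF X y]) auto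
    have "(\<lambda>n. norm_of X (?head m n)) \<longlonglongrightarrow> 0"
      by (rule koethe_truncation_tendsto_0[OF X]) (use tendsto_of_real[OF u(3)] in simp)
    then obtain M where M: "\<And>n. n \<ge> M \<Longrightarrow> norm_of X (?head m n) < e / 2"
      using order_tendstoD(2)[of _ 0 _ "e / 2"] e by (fastforce simp: eventually_sequentially)
    have "norm_of X (\<lambda>k. of_real (u n k)) < e" if n: "n \<ge> M" for n
    proof -
      let ?rest = "\<lambda>k. if m \<le> k then of_real (u n k) else (0::'a)"
      have "norm (?rest k) \<le> norm (?tail m k)" for k
        using u(1,2) by auto
      then have restX: "?rest \<in> carrier X" and le: "norm_of X ?rest \<le> norm_of X (?tail m)"
        by (rule koethe_ideal[OF X tailX], rule koethe_norm_mono[OF X tailX])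
      have headX: "?head m n \<in> carrier X"
        by (rule koethe_ideal[OF X y]) (use u(1,2) in auto)
      have "(\<lambda>k. of_real (u n k)) = (\<lambda>k. ?head m n k + ?rest k)"
        by auto
      then have "norm_of X (\<lambda>k. of_real (u n k)) \<le> norm_of X (?head m n) + norm_of X ?rest"
        using koethe_norm_triangle[OF X headX restX] by simp
      then show ?thesis
        using le m M[OF n] by linarith
    qed
    moreover have "(\<lambda>k. of_real (u n k)) \<in> carrier X" for n
      by (rule koethe_ideal[OF X y]) (use u(1,2) in auto)
    ultimately show "\<exists>M. \<forall>n\<ge>M. norm (norm_of X (\<lambda>k. of_real (u n k)) - 0) < e"
      using koethe_norm_nonneg[OF X] by auto
  qed
  then show ?thesis
    by (rule oc_partI[OF y])
qed

text \<open>Replacing the first \<open>m\<close> entries by zeros and deleting them give equimeasurable sequences.\<close>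
lemma tail_shift:
  fixes X :: "'a::real_normed_field seq_space"
  assumes "rearrangement_invariant X" "(\<lambda>k. y (k + m)) \<in> carrier X"
  shows "(\<lambda>k. if m \<le> k then y k else 0) \<in> carrier X"
    and "norm_of X (\<lambda>k. if m \<le> k then y k else 0) = norm_of X (\<lambda>k. y (k + m))"
proof -
  have "equimeasurable (\<lambda>k. if m \<le> k then y k else 0) (\<lambda>k. y (k + m))"
    unfolding equimeasurable_def
  proof (intro allI impI)
    fix t :: real
    assume "0 \<le> t"
    \<comment> \<open>The zeros in front do not count, as the level is nonnegative.\<close>
    then have "k \<in> {k. norm (if m \<le> k then y k else 0) > t}
        \<longleftrightarrow> k \<in> (\<lambda>k. k + m) ` {k. norm (y (k + m)) > t}" for k
      by (auto intro: image_eqI[of _ _ "k - m"])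
    then have "{k. norm (if m \<le> k then y k else 0) > t}
        = (\<lambda>k. k + m) ` {k. norm (y (k + m)) > t}"
      by blast
    moreover have "inj_on (\<lambda>k. k + m) {k. norm (y (k + m)) > t}"
      by simp
    ultimately show "distribution_fun (\<lambda>k. if m \<le> k then y k else 0) t
        = distribution_fun (\<lambda>k. y (k + m)) t"
      by (simp add: distribution_fun_def emeasure_count_space finite_image_iff card_image)
  qed
  then show "(\<lambda>k. if m \<le> k then y k else 0) \<in> carrier X"
    and "norm_of X (\<lambda>k. if m \<le> k then y k else 0) = norm_of X (\<lambda>k. y (k + m))"
    using assms unfolding rearrangement_invariant_def by blast+
qed

section \<open>Order continuous parts of symmetrized weighted spaces\<close>

lemma carrier_symmetrization_weighted:
  "x \<in> carrier (symmetrization (weighted X w)) \<longleftrightarrow>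
    bounded (range x) \<and> (\<lambda>k. of_real (decr_rearr x k) * of_real (w k)) \<in> carrier X"
  by (simp add: symmetrization_def weighted_def)

lemma norm_symmetrization_weighted:
  "norm_of (symmetrization (weighted X w)) x
    = norm_of X (\<lambda>k. of_real (decr_rearr x k) * of_real (w k))"
  by (simp add: symmetrization_def weighted_def)

lemma oc_symmetrization_weighted_subset:
  fixes X :: "'a::real_normed_field seq_space"
  assumes ri: "rearrangement_invariant X" and w: "\<And>k. 0 \<le> w k" "decseq w"
    and x: "x \<in> carrier (oc_part (symmetrization (weighted X w)))"
  shows "x \<in> carrier (symmetrization (weighted (oc_part X) w))"
proof -
  let ?Z = "symmetrization (weighted X w)"
  let ?y = "\<lambda>k. of_real (decr_rearr x k) * of_real (w k) :: 'a"
  let ?u = "\<lambda>n k. if n \<le> k then norm (x k) else 0"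
  let ?v = "\<lambda>n k. of_real (decr_rearr (\<lambda>k. of_real (?u n k) :: 'a) k) * of_real (w k) :: 'a"
  let ?tail = "\<lambda>n k. if n \<le> k then ?y k else 0"
  have X: "koethe_seq_space X"
    using ri by (simp add: rearrangement_invariant_def)
  have "x \<in> carrier ?Z"
    using x by (rule oc_part_carrierD)
  then have bdd: "bounded (range x)" and y: "?y \<in> carrier X"
    by (simp_all add: carrier_symmetrization_weighted)
  have bddu: "bounded (range (\<lambda>k. of_real (?u n k) :: 'a))" for n
    by (rule bounded_range_dominated[OF bdd]) auto
  have "(\<lambda>n. ?u n k) \<longlonglongrightarrow> 0" for k
    by (rule tendsto_eventually, rule eventually_sequentiallyI[of "Suc k"]) auto
  moreover have "decseq (\<lambda>n. ?u n k)" for k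
    by (auto simp: decseq_def)
  moreover have "0 \<le> ?u n k \<and> ?u n k \<le> norm (x k)" for n k
    by auto
  ultimately have "(\<lambda>n. norm_of ?Z (\<lambda>k. of_real (?u n k))) \<longlonglongrightarrow> 0"
    by (intro oc_partD[OF x]) blast+
  then have lim: "(\<lambda>n. norm_of X (?v n)) \<longlonglongrightarrow> 0"
    by (simp only: norm_symmetrization_weighted)
  have vX: "?v n \<in> carrier X" for n
  proof (rule koethe_ideal[OF X y])
    show "norm (?v n k) \<le> norm (?y k)" for k
    proof -
      have "decr_rearr (\<lambda>k. of_real (?u n k) :: 'a) k \<le> decr_rearr x k"
        by (rule decr_rearr_mono[OF bdd]) auto
      then show ?thesis
        using decr_rearr_nonneg[OF bddu, of n k] decr_rearr_nonneg[OF bdd, of k]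
        by (simp add: norm_mult mult_right_mono)
    qed
  qed
  have shift: "norm (?y (k + n)) \<le> norm (?v n k)" for n k
  proof -
    have "decr_rearr (\<lambda>k. if n \<le> k then x k else 0) k
        \<le> decr_rearr (\<lambda>k. of_real (?u n k) :: 'a) k"
      by (rule decr_rearr_mono[OF bddu]) auto
    then have "decr_rearr x (k + n) \<le> decr_rearr (\<lambda>k. of_real (?u n k) :: 'a) k"
      using decr_rearr_shift_le_tail[OF bdd, of k n] by linarith
    moreover have "w (k + n) \<le> w k"
      using w(2) by (simp add: decseq_def)
    ultimately show ?thesis
      using decr_rearr_nonneg[OF bdd, of "k + n"] decr_rearr_nonneg[OF bddu, of n k] w(1)
      by (auto simp: norm_mult intro!: mult_mono)
  qed
  have "(\<lambda>k. ?y (k + n)) \<in> carrier X" for n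
    by (rule koethe_ideal[OF X vX shift])
  note tail = tail_shift[OF ri, where y = ?y, OF this]
  have "norm_of X (?tail n) \<le> norm_of X (?v n)" for n
    unfolding tail(2) by (rule koethe_norm_mono[OF X vX shift])
  then have "(\<lambda>n. norm_of X (?tail n)) \<longlonglongrightarrow> 0"
    by (intro tendsto_sandwich[OF _ _ tendsto_const lim] always_eventually allI
        koethe_norm_nonneg[OF X tail(1)])
  then show ?thesis
    using oc_part_if_tails_tendsto_0[OF X y] bdd
    by (simp add: carrier_symmetrization_weighted)
qed

lemma symmetrization_weighted_oc_subset:
  fixes X :: "'a::real_normed_field seq_space"
  assumes X: "koethe_seq_space X" and w: "\<And>k. 0 \<le> w k" "(\<lambda>k. of_real (w k)) \<notin> carrier X"
    and x: "x \<in> carrier (symmetrization (weighted (oc_part X) w))"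
  shows "x \<in> carrier (oc_part (symmetrization (weighted X w)))"
proof -
  let ?Z = "symmetrization (weighted X w)"
  let ?y = "\<lambda>k. of_real (decr_rearr x k) * of_real (w k) :: 'a"
  have bdd: "bounded (range x)" and yo: "?y \<in> carrier (oc_part X)"
    using x by (simp_all add: carrier_symmetrization_weighted)
  have y: "?y \<in> carrier X"
    using yo by (rule oc_part_carrierD)
  \<comment> \<open>This is where \<open>w \<notin> X\<close> enters: infinitely many entries above \<open>e\<close> would keep \<open>x\<^sup>\<star>\<close> above \<open>e\<close>
    and thereby force \<open>w\<close> into \<open>X\<close>.\<close>
  have fin: "finite {k. norm (x k) > e}" if e: "e > 0" for e
  proof (rule ccontr)
    assume "infinite {k. norm (x k) > e}"
    then have ge: "e \<le> decr_rearr x n" for n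
      using finite_if_decr_rearr_less[OF bdd, of n e] by (cases "e \<le> decr_rearr x n") auto
    have "(\<lambda>k. of_real e * of_real (w k)) \<in> carrier X"
    proof (rule koethe_ideal[OF X y])
      show "norm (of_real e * of_real (w k) :: 'a) \<le> norm (?y k)" for k
        using ge[of k] e by (auto simp: norm_mult intro!: mult_right_mono)
    qed
    then have "(\<lambda>k. of_real (1 / e) * (of_real e * of_real (w k))) \<in> carrier X"
      by (rule koethe_scale[OF X])
    moreover have "of_real (1 / e) * (of_real e * of_real (w k)) = (of_real (w k) :: 'a)" for k
      using e by simp
    ultimately show False
      using w(2) by simp
  qed
  have "(\<lambda>n. norm_of ?Z (\<lambda>k. of_real (u n k))) \<longlonglongrightarrow> 0"
    if u: "\<And>n k. 0 \<le> u n k" "\<And>n k. u n k \<le> norm (x k)" "\<And>k. decseq (\<lambda>n. u n k)"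
      "\<And>k. (\<lambda>n. u n k) \<longlonglongrightarrow> 0"
    for u :: "nat \<Rightarrow> nat \<Rightarrow> real"
  proof -
    let ?r = "\<lambda>n. decr_rearr (\<lambda>k. of_real (u n k) :: 'a)"
    let ?v = "\<lambda>n k. ?r n k * w k"
    have bddu: "bounded (range (\<lambda>k. of_real (u n k) :: 'a))" for n
      by (rule bounded_range_dominated[OF bdd]) (use u(1,2) in auto)
    have r0: "0 \<le> ?r n k" for n k
      by (rule decr_rearr_nonneg[OF bddu])
    have rx: "?r n k \<le> decr_rearr x k" for n k
      by (rule decr_rearr_mono[OF bdd]) (use u(1,2) in auto)
    have rdec: "decseq (\<lambda>n. ?r n k)" for k
      unfolding decseq_def
      by (intro allI impI decr_rearr_mono[OF bddu]) (use u(1,3) in \<open>auto simp: decseq_def\<close>)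
    have rlim: "(\<lambda>n. ?r n k) \<longlonglongrightarrow> 0" for k
    proof (rule tendstoI)
      fix e :: real
      assume e: "e > 0"
      have "\<forall>\<^sub>F n in sequentially. \<forall>k. \<bar>u n k\<bar> \<le> e / 2"
        by (rule dominated_eventually_small[OF fin]) (use e u in auto)
      then show "\<forall>\<^sub>F n in sequentially. dist (?r n k) 0 < e"
      proof eventually_elim
        case (elim n)
        then have "?r n k \<le> e / 2"
          by (intro decr_rearr_le_bound) simp
        then show ?case
          using r0[of n k] e by simp
      qed
    qed
    have "0 \<le> ?v n k \<and> ?v n k \<le> norm (?y k)" for n k
      using r0[of n k] rx[of n k] w(1)[of k]
      by (auto simp: norm_mult intro!: mult_mono)
    moreover have "decseq (\<lambda>n. ?v n k)" for k
      using rdec[of k] w(1) by (auto simp: decseq_def intro!: mult_right_mono)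
    moreover have "(\<lambda>n. ?v n k) \<longlonglongrightarrow> 0" for k
      using tendsto_mult_right[OF rlim[of k], of "w k"] by simp
    ultimately have "(\<lambda>n. norm_of X (\<lambda>k. of_real (?v n k))) \<longlonglongrightarrow> 0"
      by (intro oc_partD[OF yo]) blast+
    then show ?thesis
      by (simp add: norm_symmetrization_weighted)
  qed
  moreover have "x \<in> carrier ?Z"
    using bdd y by (simp add: carrier_symmetrization_weighted)
  ultimately show ?thesis
    by (rule oc_partI[rotated])
qed

theorem lemma6p7:
  fixes X :: "'a::real_normed_field seq_space" and w :: "real \<Rightarrow> real"
  assumes "rearrangement_invariant X"
    and "fatou_property X"
    and "\<forall>t>0. w t > 0"
    and "antimono_on {0<..} w"
    and "(\<lambda>k. of_real (seq_of w k)) \<notin> carrier X"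
    and "banach_up_to_equiv_norm (symmetrization (weighted X (seq_of w)))"
  defines "L \<equiv> oc_part (symmetrization (weighted X (seq_of w)))"
    and "R \<equiv> symmetrization (weighted (oc_part X) (seq_of w))"
  shows "carrier L = carrier R \<and> (\<forall>x\<in>carrier L. norm_of L x = norm_of R x)"
proof -
  have X: "koethe_seq_space X"
    using assms(1) by (simp add: rearrangement_invariant_def)
  have pos: "0 \<le> seq_of w k" for k
    using assms(3) by (simp add: seq_of_def less_imp_le)
  have dec: "decseq (seq_of w)"
    using assms(4) by (auto simp: decseq_def seq_of_def monotone_on_def)
  have "carrier L = carrier R"
    unfolding L_def R_def
    using oc_symmetrization_weighted_subset[OF assms(1) pos dec]
      symmetrization_weighted_oc_subset[OF X pos assms(5)]
    by blast
  moreover have "norm_of L x = norm_of R x" for x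
    by (simp add: L_def R_def oc_part_def symmetrization_def weighted_def)
  ultimately show ?thesis
    by simp
qed

end
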